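(* Let $d=3$ and consider a three-dimensional $(\lambda,\nu)$-quasilinear system $A^{0}(U)U_{t}+\sum_{i=1}^{3}A^{i}_{\lambda\nu}(U)\,\partial_{i}U+Q(U)=0$, as described in the context, with the property that $\lambda+\nu=0$ on $\mathcal{D}$. This system is hyperbolic if and only if $(\lambda,\nu)=(1,-1)$ on $\mathcal{D}$ (i.e. $\lambda\equiv 1$ and $\nu\equiv-1$).
   Context: Standing assumptions. $\mathcal{D}:=\{(\rho,\theta)\in\mathbb{R}^{2}:\rho>0,\ \theta>0\}$. The pressure $p$, internal energy $e$ and thermal conductivity $\kappa$ are given smooth functions of $(\rho,\theta)\in\mathcal{D}$ such that $p,\,p_{\rho},\,p_{\theta},\,e_{\theta},\,\kappa>0$ on $\mathcal{D}$ (subscripts $\rho,\theta$ denote partial derivatives). $\lambda$ and $\nu$ are real-valued functions of $(\rho,\theta)\in\mathcal{D}$. $\tau>0$ is a constant (relaxation time). Three-dimensional system. The state variable is $U=(\rho,v,\theta,q)^{\top}\in\mathcal{O}:=\{(\rho,v,\theta,q)\in\mathbb{R}\times\mathbb{R}^{3}\times\mathbb{R}\times\mathbb{R}^{3}:\rho>0,\ \theta>0\}\subset\mathbb{R}^{8}$. All of $p,e,\kappa,\lambda,\nu$ and their derivatives are evaluated at $(\rho,\theta)$. $A^{0}(U)=\operatorname{diag}(1,\rho\mathbb{I}_{3},\rho e_{\theta},\tau\mathbb{I}_{3})$ and $Q(U)=(0,0,0,0,0,q_{1},q_{2},q_{3})^{\top}$. The matrices $A^{i}_{\lambda\nu}(U)$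 are determined by the symbol $A_{\lambda\nu}(\xi;U)=\sum_{i=1}^{3}A^{i}_{\lambda\nu}(U)\xi_{i}$, which in block form (blocks of sizes $1,3,1,3$, with $\xi$ a column vector) is $$A_{\lambda\nu}(\xi;U)=\begin{pmatrix}\xi\cdot v&\rho\,\xi^{\top}&0&0\\ p_{\rho}\,\xi&\rho(\xi\cdot v)\mathbb{I}_{3}&p_{\theta}\,\xi&0\\0&\theta p_{\theta}\,\xi^{\top}&\rho e_{\theta}\,\xi\cdot v&\xi^{\top}\\0&\tau\mathcal{Q}_{\lambda,\nu}(\xi;q)&\kappa\,\xi&\tau(\xi\cdot v)\mathbb{I}_{3}\end{pmatrix},$$ where, with $\gamma:=\lambda+\nu$, $\lambda^{+}:=\frac{\lambda}{2}+\frac12$, $\lambda^{-}:=\frac{\lambda}{2}-\frac12$, $$\mathcal{Q}_{\lambda,\nu}(\xi;q)=\begin{pmatrix}\gamma\xi_{1}q_{1}+\lambda^{-}(\xi_{2}q_{2}+\xi_{3}q_{3})&\lambda^{+}\xi_{1}q_{2}+\nu\xi_{2}q_{1}&\lambda^{+}\xi_{1}q_{3}+\nu\xi_{3}q_{1}\\ \lambda^{+}\xi_{2}q_{1}+\nu\xi_{1}q_{2}&\gamma\xi_{2}q_{2}+\lambda^{-}(\xi_{1}q_{1}+\xi_{3}q_{3})&\lambda^{+}\xi_{2}q_{3}+\nu\xi_{3}q_{2}\\ \lambda^{+}\xi_{3}q_{1}+\nu\xi_{1}q_{3}&\lambda^{+}\xi_{3}q_{2}+\nu\xi_{2}q_{3}&\gamma\xi_{3}q_{3}+\lambda^{-}(\xi_{1}q_{1}+\xi_{2}q_{2})\end{pmatrix}.$$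 Hyperbolicity. The system is called hyperbolic if for every fixed state $U\in\mathcal{O}$ and every $\xi\in\mathbb{S}^{2}$ the matrix $A^{0}(U)$ is nonsingular and the generalized eigenvalue problem $\left(A_{\lambda\nu}(\xi;U)-\eta A^{0}(U)\right)V=0$ has only real eigenvalues $\eta$ and $8$ linearly independent eigenvectors. *)

theory Defs
  imports "HOL-Analysis.Analysis"
begin

section \<open>Functions of density and temperature\<close>

definition D :: "(real \<times> real) set" where
  "D = {(r, t). r > 0 \<and> t > 0}"

definition d_rho :: "(real \<times> real \<Rightarrow> real) \<Rightarrow> real \<times> real \<Rightarrow> real" where
  "d_rho f = (\<lambda>(r, t). deriv (\<lambda>s. f (s, t)) r)"

definition d_theta :: "(real \<times> real \<Rightarrow> real) \<Rightarrow> real \<times> real \<Rightarrow> real" where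
  "d_theta f = (\<lambda>(r, t). deriv (\<lambda>s. f (r, s)) t)"

text \<open>\<open>Ck k f\<close>: \<open>f\<close> is of class \<open>C\<^sup>k\<close> on the open set \<^const>\<open>D\<close>. Differentiability makes the
  two \<^const>\<open>deriv\<close>-based partial derivatives meaningful at every point of \<^const>\<open>D\<close>.\<close>

primrec Ck :: "nat \<Rightarrow> (real \<times> real \<Rightarrow> real) \<Rightarrow> bool" where
  "Ck 0 f \<longleftrightarrow> continuous_on D f"
| "Ck (Suc k) f \<longleftrightarrow> f differentiable_on D \<and> Ck k (d_rho f) \<and> Ck k (d_theta f)"

definition smooth_on_D :: "(real \<times> real \<Rightarrow> real) \<Rightarrow> bool" where
  "smooth_on_D f \<longleftrightarrow> (\<forall>k. Ck k f)"


section \<open>The state space\<close>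

text \<open>The eight coordinates of \<open>U = (\<rho>, v, \<theta>, q)\<close>. Using them as index type of vectors and
  matrices makes the block structure (sizes 1, 3, 1, 3) available by pattern matching.\<close>

datatype comp = Rho | Vel 3 | Theta | Flux 3

lemma UNIV_comp: "UNIV = insert Rho (insert Theta (range Vel \<union> range Flux))"
proof -
  have "x \<in> insert Rho (insert Theta (range Vel \<union> range Flux))" for x
    by (cases x) auto
  then show ?thesis by blast
qed

instance comp :: finite
proof
  show "finite (UNIV :: comp set)"
    unfolding UNIV_comp by simp
qed

lemma sum_comp:
  fixes f :: "comp \<Rightarrow> 'a::comm_monoid_add"
  shows "(\<Sum>i\<in>UNIV. f i) = f Rho + (\<Sum>a\<in>UNIV. f (Vel a)) + f Theta + (\<Sum>a\<in>UNIV. f (Flux a))"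
proof -
  have "sum f (range Vel \<union> range Flux) = sum f (range Vel) + sum f (range Flux)"
    by (rule sum.union_disjoint) auto
  moreover have "sum f (range Vel) = (\<Sum>a\<in>UNIV. f (Vel a))"
    by (subst sum.reindex) (auto simp: inj_def)
  moreover have "sum f (range Flux) = (\<Sum>a\<in>UNIV. f (Flux a))"
    by (subst sum.reindex) (auto simp: inj_def)
  moreover have "sum f (insert Rho (insert Theta (range Vel \<union> range Flux)))
      = f Rho + (f Theta + sum f (range Vel \<union> range Flux))"
    by (subst sum.insert, auto)+
  ultimately show ?thesis
    unfolding UNIV_comp by (simp add: ac_simps)
qed

lemma CARD_comp: "CARD(comp) = 8"
  using sum_comp [of "\<lambda>_. 1::nat"] by simp

type_synonym state = "real ^ comp"
type_synonym matrix8 = "real ^ comp ^ comp"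

definition rho :: "state \<Rightarrow> real" where "rho U = U $ Rho"
definition vel :: "state \<Rightarrow> real ^ 3" where "vel U = (\<chi> a. U $ Vel a)"
definition theta :: "state \<Rightarrow> real" where "theta U = U $ Theta"
definition flux :: "state \<Rightarrow> real ^ 3" where "flux U = (\<chi> a. U $ Flux a)"

definition states :: "state set" where
  "states = {U. rho U > 0 \<and> theta U > 0}"


section \<open>Quasilinear systems and hyperbolicity\<close>

text \<open>The coefficients of \<open>A\<^sup>0(U) U\<^sub>t + \<Sum>\<^sub>i A\<^sup>i(U) \<partial>\<^sub>i U + Q(U) = 0\<close> in three space dimensions.\<close>

record quasilinear_system =
  A0 :: "state \<Rightarrow> matrix8"
  A :: "3 \<Rightarrow> state \<Rightarrow> matrix8"
  Q :: "state \<Rightarrow> state"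

definition symbol :: "quasilinear_system \<Rightarrow> real ^ 3 \<Rightarrow> state \<Rightarrow> matrix8" where
  "symbol S \<xi> U = (\<Sum>i\<in>UNIV. (\<xi> $ i) *\<^sub>R A S i U)"

definition gen_eigenvector ::
    "'a::field ^ 'n ^ 'n \<Rightarrow> 'a ^ 'n ^ 'n \<Rightarrow> 'a \<Rightarrow> 'a ^ 'n \<Rightarrow> bool" where
  "gen_eigenvector M N \<eta> V \<longleftrightarrow> V \<noteq> 0 \<and> (\<chi> i j. M $ i $ j - \<eta> * N $ i $ j) *v V = 0"

definition gen_eigenvalue :: "'a::field ^ 'n ^ 'n \<Rightarrow> 'a ^ 'n ^ 'n \<Rightarrow> 'a \<Rightarrow> bool" where
  "gen_eigenvalue M N \<eta> \<longleftrightarrow> (\<exists>V. gen_eigenvector M N \<eta> V)"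

definition complexify :: "real ^ 'n ^ 'm \<Rightarrow> complex ^ 'n ^ 'm" where
  "complexify M = (\<chi> i j. complex_of_real (M $ i $ j))"

text \<open>Eigenvalues are taken over the complex numbers, so that requiring them to be real is a genuine
  condition; the eight eigenvectors then belong to real eigenvalues and are taken real. The source
  term does not enter.\<close>

definition hyperbolic :: "quasilinear_system \<Rightarrow> bool" where
  "hyperbolic S \<longleftrightarrow> (\<forall>U\<in>states. \<forall>\<xi>\<in>sphere 0 1.
     invertible (A0 S U) \<and>
     (\<forall>\<eta>. gen_eigenvalue (complexify (symbol S \<xi> U)) (complexify (A0 S U)) \<eta> \<longrightarrow> \<eta> \<in> \<real>) \<and>
     (\<exists>B. independent B \<and> card B = 8 \<and>
        (\<forall>V\<in>B. \<exists>\<eta>. gen_eigenvector (symbol S \<xi> U) (A0 S U) \<eta> V)))"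


section \<open>The three-dimensional system\<close>

text \<open>The parameters \<open>l\<close> and \<open>n\<close> are the values of \<open>\<lambda>\<close> and \<open>\<nu>\<close> at the given state.\<close>

definition Q_block :: "real \<Rightarrow> real \<Rightarrow> real ^ 3 \<Rightarrow> real ^ 3 \<Rightarrow> real ^ 3 ^ 3" where
  "Q_block l n \<xi> q =
    (let g = l + n; lp = l / 2 + 1 / 2; lm = l / 2 - 1 / 2 in
     vector
      [vector [g * \<xi>$1 * q$1 + lm * (\<xi>$2 * q$2 + \<xi>$3 * q$3),
               lp * \<xi>$1 * q$2 + n * \<xi>$2 * q$1,
               lp * \<xi>$1 * q$3 + n * \<xi>$3 * q$1],
       vector [lp * \<xi>$2 * q$1 + n * \<xi>$1 * q$2,
               g * \<xi>$2 * q$2 + lm * (\<xi>$1 * q$1 + \<xi>$3 * q$3),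
               lp * \<xi>$2 * q$3 + n * \<xi>$3 * q$2],
       vector [lp * \<xi>$3 * q$1 + n * \<xi>$1 * q$3,
               lp * \<xi>$3 * q$2 + n * \<xi>$2 * q$3,
               g * \<xi>$3 * q$3 + lm * (\<xi>$1 * q$1 + \<xi>$2 * q$2)]])"

definition A0_ln :: "(real \<times> real \<Rightarrow> real) \<Rightarrow> real \<Rightarrow> state \<Rightarrow> matrix8" where
  "A0_ln e \<tau> U = (\<chi> i j. if i = j then
      (case i of Rho \<Rightarrow> 1 | Vel a \<Rightarrow> rho U | Theta \<Rightarrow> rho U * d_theta e (rho U, theta U) | Flux a \<Rightarrow> \<tau>)
    else 0)"

definition A_ln ::
    "(real \<times> real \<Rightarrow> real) \<Rightarrow> (real \<times> real \<Rightarrow> real) \<Rightarrow> (real \<times> real \<Rightarrow> real) \<Rightarrow> real \<Rightarrow>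
     (real \<times> real \<Rightarrow> real) \<Rightarrow> (real \<times> real \<Rightarrow> real) \<Rightarrow> real ^ 3 \<Rightarrow> state \<Rightarrow> matrix8" where
  "A_ln p e \<kappa> \<tau> lam nu \<xi> U =
    (let x = (rho U, theta U); \<xi>v = \<xi> \<bullet> vel U; I = (mat 1 :: real ^ 3 ^ 3);
         QB = Q_block (lam x) (nu x) \<xi> (flux U) in
     \<chi> i j. case i of
       Rho \<Rightarrow> (case j of
           Rho \<Rightarrow> \<xi>v
         | Vel b \<Rightarrow> rho U * \<xi> $ b
         | Theta \<Rightarrow> 0
         | Flux b \<Rightarrow> 0)
     | Vel a \<Rightarrow> (case j of
           Rho \<Rightarrow> d_rho p x * \<xi> $ a
         | Vel b \<Rightarrow> rho U * \<xi>v * I $ a $ b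
         | Theta \<Rightarrow> d_theta p x * \<xi> $ a
         | Flux b \<Rightarrow> 0)
     | Theta \<Rightarrow> (case j of
           Rho \<Rightarrow> 0
         | Vel b \<Rightarrow> theta U * d_theta p x * \<xi> $ b
         | Theta \<Rightarrow> rho U * d_theta e x * \<xi>v
         | Flux b \<Rightarrow> \<xi> $ b)
     | Flux a \<Rightarrow> (case j of
           Rho \<Rightarrow> 0
         | Vel b \<Rightarrow> \<tau> * QB $ a $ b
         | Theta \<Rightarrow> \<kappa> x * \<xi> $ a
         | Flux b \<Rightarrow> \<tau> * \<xi>v * I $ a $ b))"

definition Q_source :: "state \<Rightarrow> state" where
  "Q_source U = (\<chi> i. case i of Rho \<Rightarrow> 0 | Vel a \<Rightarrow> 0 | Theta \<Rightarrow> 0 | Flux a \<Rightarrow> flux U $ a)"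

text \<open>The matrix \<open>A\<^sup>i\<close> is the value of the (linear) prescribed symbol at the \<open>i\<close>-th unit vector.\<close>

definition ln_system ::
    "(real \<times> real \<Rightarrow> real) \<Rightarrow> (real \<times> real \<Rightarrow> real) \<Rightarrow> (real \<times> real \<Rightarrow> real) \<Rightarrow> real \<Rightarrow>
     (real \<times> real \<Rightarrow> real) \<Rightarrow> (real \<times> real \<Rightarrow> real) \<Rightarrow> quasilinear_system" where
  "ln_system p e \<kappa> \<tau> lam nu =
    \<lparr>A0 = A0_ln e \<tau>, A = (\<lambda>i. A_ln p e \<kappa> \<tau> lam nu (axis i 1)), Q = Q_source\<rparr>"

lemma symbol_ln_system: "symbol (ln_system p e \<kappa> \<tau> lam nu) \<xi> U = A_ln p e \<kappa> \<tau> lam nu \<xi> U"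
proof -
  have ax: "axis i (1::real) $ j = (if j = i then 1 else 0)" for i j :: 3
    by (simp add: axis_def)
  have "symbol (ln_system p e \<kappa> \<tau> lam nu) \<xi> U $ i $ j = A_ln p e \<kappa> \<tau> lam nu \<xi> U $ i $ j" for i j
  proof -
    have q: "(\<Sum>k\<in>UNIV. \<xi> $ k * Q_block l n (axis k 1) w $ a $ b) = Q_block l n \<xi> w $ a $ b"
      for l n w a b
      using exhaust_3 [of a] exhaust_3 [of b]
      by (auto simp: Q_block_def Let_def sum_3 ax algebra_simps)
    have s: "(\<Sum>k\<in>UNIV. \<xi> $ k * axis k 1 $ a) = \<xi> $ a" for a
      using exhaust_3 [of a] by (auto simp: sum_3 ax)
    have v: "(\<Sum>k\<in>UNIV. \<xi> $ k * (axis k 1 \<bullet> w)) = \<xi> \<bullet> w" for w :: "real ^ 3"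
      by (simp add: inner_vec_def sum_3 ax)
    have c1: "(\<Sum>k\<in>UNIV. \<xi> $ k * (c * f k)) = c * (\<Sum>k\<in>UNIV. \<xi> $ k * f k)" for c f
      by (simp add: sum_3 algebra_simps)
    have c2: "(\<Sum>k\<in>UNIV. \<xi> $ k * (f k * c)) = (\<Sum>k\<in>UNIV. \<xi> $ k * f k) * c" for c f
      by (simp add: sum_3 algebra_simps)
    have c3: "(\<Sum>k\<in>UNIV. \<xi> $ k * (c * f k * d)) = c * (\<Sum>k\<in>UNIV. \<xi> $ k * f k) * d" for c d f
      by (simp add: sum_3 algebra_simps)
    show ?thesis
      by (cases i; cases j)
        (simp_all add: symbol_def ln_system_def A_ln_def Let_def c1 c2 c3 q s v)
  qed
  then show ?thesis by (simp add: vec_eq_iff)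
qed

end

(* Write an eigenvector as (r, w, t, s) and split w and s into parts along and across xi.
   The transversal part of w vanishes in every eigenvector of nonzero relative speed, so the kernel
   has to supply it; since lambda + nu = 0, the flux equation allows this for all q only if
   lambda = 1. For lambda = 1 the kernel contains all transversal directions, and the remaining
   four-dimensional longitudinal problem has the speeds +-sqrt y, +-sqrt z, where y and z are
   distinct positive roots of a quadratic. *)

theory Submission
  imports Defs
begin

section \<open>Diagonalizable matrix pencils\<close>

definition cvec :: "real ^ 'n \<Rightarrow> complex ^ 'n" where
  "cvec v = (\<chi> i. complex_of_real (v $ i))"

lemma cvec_add: "cvec (v + w) = cvec v + cvec w"
  by (simp add: cvec_def vec_eq_iff)

lemma cvec_scaleR: "cvec (c *\<^sub>R v) = complex_of_real c *s cvec v"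
  by (simp add: cvec_def vec_eq_iff)

lemma cvec_0 [simp]: "cvec 0 = 0"
  by (simp add: cvec_def vec_eq_iff)

lemma complexify_cvec: "complexify M *v cvec v = cvec (M *v v)"
  by (simp add: complexify_def cvec_def vec_eq_iff matrix_vector_mult_def)

lemma cvec_Re_Im: "z = cvec (\<chi> i. Re (z $ i)) + \<i> *s cvec (\<chi> i. Im (z $ i))"
  by (simp add: cvec_def vec_eq_iff complex_eq)

lemma pencil_mult:
  fixes M N :: "'a::field ^ 'n ^ 'm"
  shows "(\<chi> i j. M $ i $ j - \<eta> * N $ i $ j) *v V = M *v V - \<eta> *s (N *v V)"
  by (simp add: vec_eq_iff matrix_vector_mult_def left_diff_distrib sum_subtractf
      sum_distrib_left mult.assoc)

text \<open>If \<open>\<eta>\<close> were not real, the pencil at \<open>\<eta>\<close> would act on a real eigenvector \<open>V\<close> with eigenvalue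
  \<open>\<zeta>\<close> as the nonzero multiple \<open>\<zeta> - \<eta>\<close> of \<open>N V\<close>. Since these \<open>V\<close> span, it would be surjective,
  hence injective.\<close>

lemma gen_eigenvalue_real:
  fixes M N :: "real ^ 'n ^ 'n"
  assumes inv: "invertible N"
    and span: "span {V. \<exists>\<zeta>. gen_eigenvector M N \<zeta> V} = UNIV"
    and ev: "gen_eigenvalue (complexify M) (complexify N) \<eta>"
  shows "\<eta> \<in> \<real>"
proof (rule ccontr)
  assume nonreal: "\<eta> \<notin> \<real>"
  define P where "P = (\<chi> i j. complexify M $ i $ j - \<eta> * complexify N $ i $ j)"
  have Pv: "P *v z = complexify M *v z - \<eta> *s (complexify N *v z)" for z
    unfolding P_def by (rule pencil_mult)
  \<comment> \<open>\<open>X\<close> is a real subspace, which suffices to absorb the span of the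
    real eigenvectors. Complex right-hand sides are treated afterwards through their real and
    imaginary parts, by linearity of \<open>P\<close>.\<close>
  define X where "X = {V. \<exists>z. P *v z = cvec (N *v V)}"
  have "subspace X"
  proof (rule subspaceI)
    show "0 \<in> X"
      unfolding X_def by (auto intro: exI [of _ 0])
  next
    fix V W assume "V \<in> X" "W \<in> X"
    then obtain y z where "P *v y = cvec (N *v V)" "P *v z = cvec (N *v W)"
      unfolding X_def by blast
    then have "P *v (y + z) = cvec (N *v (V + W))"
      by (simp add: matrix_vector_right_distrib cvec_add)
    then show "V + W \<in> X" unfolding X_def by blast
  next
    fix c V assume "V \<in> X"
    then obtain z where "P *v z = cvec (N *v V)"
      unfolding X_def by blast
    then have "P *v (complex_of_real c *s z) = cvec (N *v (c *\<^sub>R V))"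
      by (simp add: vector_scalar_commute matrix_vector_mult_scaleR cvec_scaleR)
    then show "c *\<^sub>R V \<in> X" unfolding X_def by blast
  qed
  moreover have "{V. \<exists>\<zeta>. gen_eigenvector M N \<zeta> V} \<subseteq> X"
  proof
    fix V assume "V \<in> {V. \<exists>\<zeta>. gen_eigenvector M N \<zeta> V}"
    then obtain \<zeta> where "gen_eigenvector M N \<zeta> V" by blast
    then have MV: "M *v V = \<zeta> *\<^sub>R (N *v V)"
      by (simp add: gen_eigenvector_def pencil_mult scalar_mult_eq_scaleR)
    have nz: "complex_of_real \<zeta> - \<eta> \<noteq> 0"
      using nonreal by auto
    have PV: "P *v cvec V = (complex_of_real \<zeta> - \<eta>) *s cvec (N *v V)"
      by (simp add: Pv complexify_cvec MV cvec_scaleR vec_eq_iff left_diff_distrib)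
    have "P *v (inverse (complex_of_real \<zeta> - \<eta>) *s cvec V) = cvec (N *v V)"
      unfolding vector_scalar_commute PV vector_smult_assoc using nz by simp
    then show "V \<in> X" unfolding X_def by blast
  qed
  ultimately have X: "X = UNIV"
    using span span_minimal by blast
  have onto: "\<exists>z. P *v z = cvec v" for v
  proof -
    obtain V where "N *v V = v"
      using inv by (metis invertible_right_inverse matrix_right_invertible_surjective surjD)
    moreover have "V \<in> X" using X by simp
    ultimately show ?thesis unfolding X_def by auto
  qed
  have "\<exists>z. P *v z = y" for y
  proof -
    obtain a b where "P *v a = cvec (\<chi> i. Re (y $ i))" "P *v b = cvec (\<chi> i. Im (y $ i))"
      using onto by metis
    then have "P *v (a + \<i> *s b) = y"
      by (simp add: matrix_vector_right_distrib vector_scalar_commute flip: cvec_Re_Im)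
    then show ?thesis ..
  qed
  then have "invertible P"
    by (metis invertible_right_inverse matrix_right_invertible_surjective surjI)
  moreover obtain V where "V \<noteq> 0" "P *v V = 0"
    using ev unfolding gen_eigenvalue_def gen_eigenvector_def P_def by blast
  ultimately show False
    by (metis invertible_left_inverse matrix_left_invertible_ker)
qed


section \<open>The eigenvalue problem in block form\<close>

definition block :: "real \<Rightarrow> real ^ 3 \<Rightarrow> real \<Rightarrow> real ^ 3 \<Rightarrow> state" where
  "block r w t s = (\<chi> i. case i of Rho \<Rightarrow> r | Vel a \<Rightarrow> w $ a | Theta \<Rightarrow> t | Flux a \<Rightarrow> s $ a)"

lemma block_sel [simp]:
  "rho (block r w t s) = r" "vel (block r w t s) = w"
  "theta (block r w t s) = t" "flux (block r w t s) = s"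
  by (simp_all add: block_def rho_def vel_def theta_def flux_def)

lemma state_eq_iff:
  "U = V \<longleftrightarrow> rho U = rho V \<and> vel U = vel V \<and> theta U = theta V \<and> flux U = flux V"
proof
  assume eq: "rho U = rho V \<and> vel U = vel V \<and> theta U = theta V \<and> flux U = flux V"
  have "U $ i = V $ i" for i
    using eq by (cases i) (auto simp: rho_def vel_def theta_def flux_def vec_eq_iff)
  then show "U = V" by (simp add: vec_eq_iff)
qed simp

lemma state_add [simp]:
  "rho (U + V) = rho U + rho V" "vel (U + V) = vel U + vel V"
  "theta (U + V) = theta U + theta V" "flux (U + V) = flux U + flux V"
  by (simp_all add: rho_def vel_def theta_def flux_def vec_eq_iff)

lemma state_scaleR [simp]:
  "rho (c *\<^sub>R U) = c * rho U" "vel (c *\<^sub>R U) = c *\<^sub>R vel U"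
  "theta (c *\<^sub>R U) = c * theta U" "flux (c *\<^sub>R U) = c *\<^sub>R flux U"
  by (simp_all add: rho_def vel_def theta_def flux_def vec_eq_iff)

lemma state_0 [simp]: "rho 0 = 0" "vel 0 = 0" "theta 0 = 0" "flux 0 = 0"
  by (simp_all add: rho_def vel_def theta_def flux_def vec_eq_iff)

text \<open>For nu = -lambda the coefficient gamma vanishes, and lambda^+ + lambda^- = lambda turns
  the block into a multiple of the identity plus two dyads in \<open>\<xi>\<close> and
  \<open>q\<close>. If \<open>w\<close> is orthogonal to \<open>\<xi>\<close>, the dyads leave
  nothing across \<open>\<xi>\<close>, so the obstruction at lambda other than 1 is the identity
  term.\<close>

lemma Q_block_mult:
  "Q_block l (- l) \<xi> q *v w =
    ((l - 1) / 2 * (\<xi> \<bullet> q)) *\<^sub>R w + ((l + 1) / 2 * (q \<bullet> w)) *\<^sub>R \<xi> - (l * (\<xi> \<bullet> w)) *\<^sub>R q"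
proof -
  have "(Q_block l (- l) \<xi> q *v w) $ a =
      (((l - 1) / 2 * (\<xi> \<bullet> q)) *\<^sub>R w + ((l + 1) / 2 * (q \<bullet> w)) *\<^sub>R \<xi> - (l * (\<xi> \<bullet> w)) *\<^sub>R q) $ a"
    for a
    using exhaust_3 [of a]
    by (auto simp: Q_block_def Let_def matrix_vector_mult_def sum_3 inner_vec_def field_simps)
  then show ?thesis by (simp add: vec_eq_iff)
qed

lemma A_ln_mult:
  "A_ln p e \<kappa> \<tau> lam nu \<xi> U *v V =
    (let x = (rho U, theta U); c = \<xi> \<bullet> vel U in
      block (c * rho V + rho U * (\<xi> \<bullet> vel V))
        ((d_rho p x * rho V + d_theta p x * theta V) *\<^sub>R \<xi> + (rho U * c) *\<^sub>R vel V)
        (theta U * d_theta p x * (\<xi> \<bullet> vel V) + rho U * d_theta e x * c * theta V + \<xi> \<bullet> flux V)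
        (\<tau> *\<^sub>R (Q_block (lam x) (nu x) \<xi> (flux U) *v vel V) + (\<kappa> x * theta V) *\<^sub>R \<xi>
          + (\<tau> * c) *\<^sub>R flux V))"
proof -
  have id: "(\<Sum>b\<in>UNIV. c * mat 1 $ a $ b * f b) = c * f a" for c :: real and a :: 3 and f
    by (simp add: mat_def if_distrib [of "\<lambda>x. _ * x"] if_distrib [of "\<lambda>x. x * _"] cong: if_cong)
  have inner: "\<xi> \<bullet> (\<chi> b. w b) = (\<Sum>b\<in>UNIV. \<xi> $ b * w b)" for w
    by (simp add: inner_vec_def)
  show ?thesis
    unfolding vec_eq_iff
  proof
    fix i
    show "(A_ln p e \<kappa> \<tau> lam nu \<xi> U *v V) $ i = (let x = (rho U, theta U); c = \<xi> \<bullet> vel U in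
      block (c * rho V + rho U * (\<xi> \<bullet> vel V))
        ((d_rho p x * rho V + d_theta p x * theta V) *\<^sub>R \<xi> + (rho U * c) *\<^sub>R vel V)
        (theta U * d_theta p x * (\<xi> \<bullet> vel V) + rho U * d_theta e x * c * theta V + \<xi> \<bullet> flux V)
        (\<tau> *\<^sub>R (Q_block (lam x) (nu x) \<xi> (flux U) *v vel V) + (\<kappa> x * theta V) *\<^sub>R \<xi>
          + (\<tau> * c) *\<^sub>R flux V)) $ i"
      by (cases i)
        (simp_all add: A_ln_def block_def Let_def matrix_vector_mult_def sum_comp id inner
          rho_def [of V] vel_def [of V] theta_def [of V] flux_def [of V],
         simp_all add: sum_distrib_left algebra_simps)
  qed
qed

lemma A0_ln_mult:
  "A0_ln e \<tau> U *v V = block (rho V) (rho U *\<^sub>R vel V)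
     (rho U * d_theta e (rho U, theta U) * theta V) (\<tau> *\<^sub>R flux V)"
  unfolding vec_eq_iff
proof
  fix i
  have "(A0_ln e \<tau> U *v V) $ i = (case i of Rho \<Rightarrow> 1 | Vel a \<Rightarrow> rho U
      | Theta \<Rightarrow> rho U * d_theta e (rho U, theta U) | Flux a \<Rightarrow> \<tau>) * V $ i"
    by (simp add: A0_ln_def matrix_vector_mult_def if_distrib [of "\<lambda>x. x * _"] cong: if_cong)
  then show "(A0_ln e \<tau> U *v V) $ i = block (rho V) (rho U *\<^sub>R vel V)
     (rho U * d_theta e (rho U, theta U) * theta V) (\<tau> *\<^sub>R flux V) $ i"
    by (cases i) (simp_all add: block_def rho_def [of V] vel_def theta_def [of V] flux_def)
qed

text \<open>The convective terms of the symbol add up to (xi . v) times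
  \<open>A0_ln e \<tau> U\<close>, so they merely shift \<open>\<eta>\<close> to the speed
  \<open>\<mu>\<close> relative to the fluid. The equations are the balances of mass, momentum,
  energy and heat flux.\<close>

lemma gen_eigenvector_ln_iff:
  assumes "x = (rho U, theta U)" and "\<mu> = \<eta> - \<xi> \<bullet> vel U"
  shows "gen_eigenvector (A_ln p e \<kappa> \<tau> lam nu \<xi> U) (A0_ln e \<tau> U) \<eta> V \<longleftrightarrow> V \<noteq> 0 \<and>
    rho U * (\<xi> \<bullet> vel V) = \<mu> * rho V \<and>
    (d_rho p x * rho V + d_theta p x * theta V) *\<^sub>R \<xi> = (\<mu> * rho U) *\<^sub>R vel V \<and>
    theta U * d_theta p x * (\<xi> \<bullet> vel V) + \<xi> \<bullet> flux V = \<mu> * rho U * d_theta e x * theta V \<and>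
    \<tau> *\<^sub>R (Q_block (lam x) (nu x) \<xi> (flux U) *v vel V) + (\<kappa> x * theta V) *\<^sub>R \<xi> = (\<mu> * \<tau>) *\<^sub>R flux V"
  unfolding gen_eigenvector_def pencil_mult right_minus_eq scalar_mult_eq_scaleR
  by (auto simp: A_ln_mult A0_ln_mult Let_def state_eq_iff assms algebra_simps)

lemma invertible_A0_ln:
  assumes "rho U > 0" "d_theta e (rho U, theta U) > 0" "\<tau> > 0"
  shows "invertible (A0_ln e \<tau> U)"
proof -
  have "V = 0" if "A0_ln e \<tau> U *v V = 0" for V
    using that assms by (simp add: A0_ln_mult state_eq_iff)
  then show ?thesis
    by (metis invertible_left_inverse matrix_left_invertible_ker)
qed


section \<open>The two implications\<close>

text \<open>With \<open>v = 0\<close> and \<open>q = \<xi> = axis 1 1\<close> all eigenvectors lie in the hyperplane \<open>V $ Vel 2 = 0\<close>: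
  for \<open>\<eta> \<noteq> 0\<close> by the momentum balance, for \<open>\<eta> = 0\<close> by the second flux equation, in which the
  coefficient of \<open>V $ Vel 2\<close> is \<open>\<tau> (\<lambda> - 1) / 2\<close>.\<close>

lemma hyperbolic_imp_lam_eq_1:
  assumes hyp: "hyperbolic (ln_system p e \<kappa> \<tau> lam nu)"
    and r: "r > 0" and t: "t > 0" and \<tau>: "\<tau> > 0" and sum0: "lam (r, t) + nu (r, t) = 0"
  shows "lam (r, t) = 1"
proof (rule ccontr)
  assume l: "lam (r, t) \<noteq> 1"
  have nu: "nu (r, t) = - lam (r, t)" using sum0 by simp
  define \<xi> :: "real ^ 3" where "\<xi> = axis 1 1"
  define U where "U = block r 0 t \<xi>"
  have U: "U \<in> states" and \<xi>: "\<xi> \<in> sphere 0 1"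
    using r t by (simp_all add: U_def states_def \<xi>_def)
  have \<xi>2: "\<xi> $ 2 = 0" "\<xi> \<bullet> \<xi> = 1"
    by (simp_all add: \<xi>_def inner_axis, simp add: axis_def)
  have vanish: "V $ Vel 2 = 0"
    if ev: "gen_eigenvector (A_ln p e \<kappa> \<tau> lam nu \<xi> U) (A0_ln e \<tau> U) \<eta> V" for \<eta> V
  proof -
    have mom: "(d_rho p (r, t) * rho V + d_theta p (r, t) * theta V) *\<^sub>R \<xi> = (\<eta> * r) *\<^sub>R vel V"
      and flx: "\<tau> *\<^sub>R (Q_block (lam (r, t)) (- lam (r, t)) \<xi> \<xi> *v vel V)
        + (\<kappa> (r, t) * theta V) *\<^sub>R \<xi> = (\<eta> * \<tau>) *\<^sub>R flux V"
      using ev unfolding gen_eigenvector_ln_iff [OF refl refl] by (simp_all add: U_def nu)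
    have "(\<eta> * r) * vel V $ 2 = 0"
      using arg_cong [OF mom, of "\<lambda>w. w $ 2"] by (simp add: \<xi>2)
    moreover have "\<tau> * ((lam (r, t) - 1) / 2 * vel V $ 2) = \<eta> * \<tau> * flux V $ 2"
      using arg_cong [OF flx, of "\<lambda>w. w $ 2"] by (simp add: \<xi>2 Q_block_mult)
    ultimately have "vel V $ 2 = 0"
      using r \<tau> l by auto
    then show ?thesis by (simp add: vel_def)
  qed
  obtain B where B: "independent B" "card B = 8"
    "\<forall>V\<in>B. \<exists>\<eta>. gen_eigenvector (A_ln p e \<kappa> \<tau> lam nu \<xi> U) (A0_ln e \<tau> U) \<eta> V"
    using hyp U \<xi> unfolding hyperbolic_def symbol_ln_system
    by (fastforce simp: ln_system_def)
  \<comment> \<open>Eight independent vectors span the eight-dimensional state space, so they cannot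
    all lie in a proper hyperplane.\<close>
  have "UNIV \<subseteq> span B"
    using B by (intro card_ge_dim_independent) (simp_all add: dim_UNIV CARD_comp)
  moreover have "subspace {V :: state. V $ Vel 2 = 0}"
    by (rule subspaceI) auto
  then have "span B \<subseteq> {V. V $ Vel 2 = 0}"
    using B(3) vanish by (intro span_minimal) auto
  ultimately have "axis (Vel 2) 1 \<in> {V :: state. V $ Vel 2 = 0}" by blast
  then show False by (simp add: axis_def)
qed

text \<open>The equation is x^2 - S x + a b = 0 with S = a + b + c. Its discriminant exceeds (a -
  b)^2, which separates the roots, and is below S^2 because a b > 0, which makes both
  positive.\<close>

lemma two_positive_roots:
  fixes a b c :: real
  assumes "a > 0" "b > 0" "c > 0"
  obtains x y where "x > 0" "y > 0" "x \<noteq> y"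
    "(x - a) * (x - b) = c * x" "(y - a) * (y - b) = c * y"
proof -
  define S where "S = a + b + c"
  define d where "d = S\<^sup>2 - 4 * a * b"
  have "d = (a - b)\<^sup>2 + c * (2 * a + 2 * b + c)"
    by (simp add: d_def S_def power2_eq_square algebra_simps)
  moreover have "c * (2 * a + 2 * b + c) > 0" using assms by simp
  ultimately have d: "d > 0" by (smt (verit) zero_le_power2)
  have "d < S\<^sup>2" "S > 0" using assms by (simp_all add: d_def S_def)
  have "0 < S + sqrt d"
    using d \<open>S > 0\<close> by (intro add_pos_pos) auto
  moreover have "sqrt d < S"
    using \<open>d < S\<^sup>2\<close> \<open>S > 0\<close> by (simp add: real_less_lsqrt)
  moreover have root: "(x - a) * (x - b) = c * x" if "x = (S + h) / 2" "h\<^sup>2 = d" for x h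
  proof -
    have "h\<^sup>2 = S\<^sup>2 - 4 * a * b" using that d_def by simp
    moreover have "h = 2 * x - S" using that by simp
    ultimately show ?thesis
      by (simp add: S_def power2_eq_square algebra_simps)
  qed
  ultimately show thesis
    using d root [OF refl, of "sqrt d"] root [OF refl, of "- sqrt d"]
    by (intro that [of "(S + sqrt d) / 2" "(S - sqrt d) / 2"]) auto
qed

text \<open>Spanning is the form that serves both remaining demands of hyperbolicity: it forces all
  complex eigenvalues to be real, and a basis of eigenvectors can be selected from a spanning
  set.\<close>

lemma span_eigenvectors_ln:
  assumes U: "rho U > 0" "theta U > 0" and \<xi>: "\<xi> \<bullet> \<xi> = 1" and \<tau>: "\<tau> > 0"
    and x: "x = (rho U, theta U)"
    and pos: "d_rho p x > 0" "d_theta p x > 0" "d_theta e x > 0" "\<kappa> x > 0"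
    and lam: "lam x = 1" "nu x = - 1"
  shows "span {V. \<exists>\<eta>. gen_eigenvector (A_ln p e \<kappa> \<tau> lam nu \<xi> U) (A0_ln e \<tau> U) \<eta> V} = UNIV"
    (is "span ?E = UNIV")
proof -
  define R where "R = rho U"
  define T where "T = theta U"
  define q where "q = flux U"
  define a where "a = d_rho p x"
  define m where "m = d_theta p x"
  define h where "h = d_theta e x"
  define k where "k = \<kappa> x"
  note [simp] = R_def [symmetric] T_def [symmetric] q_def [symmetric] a_def [symmetric]
    m_def [symmetric] h_def [symmetric] k_def [symmetric]
  have P: "R > 0" "T > 0" "a > 0" "m > 0" "h > 0" "k > 0"
    using U pos by simp_all
  have Qw: "Q_block (lam x) (nu x) \<xi> q *v w = (q \<bullet> w) *\<^sub>R \<xi> - (\<xi> \<bullet> w) *\<^sub>R q" for w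
    using Q_block_mult [of 1 \<xi> q w] by (simp add: lam)
  \<comment> \<open>Stating membership in the span admits \<open>V = 0\<close>, so no later witness
    has to be shown nonzero.\<close>
  have E: "V \<in> span ?E"
    if "R * (\<xi> \<bullet> vel V) = \<mu> * rho V" "(a * rho V + m * theta V) *\<^sub>R \<xi> = (\<mu> * R) *\<^sub>R vel V"
      "T * m * (\<xi> \<bullet> vel V) + \<xi> \<bullet> flux V = \<mu> * R * h * theta V"
      "\<tau> *\<^sub>R ((q \<bullet> vel V) *\<^sub>R \<xi> - (\<xi> \<bullet> vel V) *\<^sub>R q) + (k * theta V) *\<^sub>R \<xi> = (\<mu> * \<tau>) *\<^sub>R flux V"
    for \<mu> V
  proof (cases "V = 0")
    case True
    then show ?thesis by (simp add: span_0)
  next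
    case False
    then have "gen_eigenvector (A_ln p e \<kappa> \<tau> lam nu \<xi> U) (A0_ln e \<tau> U) (\<mu> + \<xi> \<bullet> vel U) V"
      unfolding gen_eigenvector_ln_iff [OF x refl] using that by (simp add: Qw)
    then show ?thesis by (blast intro: span_base)
  qed
  have flux_perp: "block 0 0 0 s \<in> span ?E" if "\<xi> \<bullet> s = 0" for s
    using that by (intro E [where \<mu> = 0]) simp_all
  \<comment> \<open>At relative speed 0 the flux equation along \<open>\<xi>\<close> dictates the
    temperature, and the momentum balance then dictates the density.\<close>
  have vel_perp: "block (m * \<tau> * (q \<bullet> w) / (k * a)) w (- \<tau> * (q \<bullet> w) / k) 0 \<in> span ?E"
    if "\<xi> \<bullet> w = 0" for w
    using that P \<tau> by (intro E [where \<mu> = 0]) simp_all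
  \<comment> \<open>The candidates for the squared relative speed. Here \<open>a\<close> is the
    squared isothermal sound speed, \<open>k / (\<tau> * R * h)\<close> the squared speed of heat
    waves, and the right-hand side couples the two.\<close>
  obtain y z where yz: "y > 0" "z > 0" "y \<noteq> z"
    and y: "(y - a) * (y - k / (\<tau> * R * h)) = T * m\<^sup>2 / (R\<^sup>2 * h) * y"
    and z: "(z - a) * (z - k / (\<tau> * R * h)) = T * m\<^sup>2 / (R\<^sup>2 * h) * z"
    using two_positive_roots [of a "k / (\<tau> * R * h)" "T * m\<^sup>2 / (R\<^sup>2 * h)"] P \<tau> by auto
  have acoustic: "block (R * m) ((\<mu> * m) *\<^sub>R \<xi>) (R * (x - a))
      (m *\<^sub>R ((\<xi> \<bullet> q) *\<^sub>R \<xi> - q) + (k * R * (x - a) / (\<tau> * \<mu>)) *\<^sub>R \<xi>) \<in> span ?E"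
    if x: "(x - a) * (x - k / (\<tau> * R * h)) = T * m\<^sup>2 / (R\<^sup>2 * h) * x"
      and \<mu>: "\<mu>\<^sup>2 = x" "\<mu> \<noteq> 0" for x \<mu>
    \<comment> \<open>Eliminating everything but the longitudinal velocity and the temperature leaves this
      quadratic equation for the square of the speed \<open>\<mu>\<close> relative to \<open>\<xi> \<bullet> v\<close>.\<close>
  proof (rule E [where \<mu> = \<mu>], unfold block_sel)
    \<comment> \<open>With the velocity normalised to \<open>(\<mu> * m) *\<^sub>R \<xi>\<close>,
      the mass, momentum and flux equations determine density, temperature and flux in turn. The
      quadratic enters only in the energy balance.\<close>
    show "R * (\<xi> \<bullet> (\<mu> * m) *\<^sub>R \<xi>) = \<mu> * (R * m)"
      by (simp add: \<xi>)
    show "(a * (R * m) + m * (R * (x - a))) *\<^sub>R \<xi> = (\<mu> * R) *\<^sub>R (\<mu> * m) *\<^sub>R \<xi>"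
      using \<mu> by (simp add: power2_eq_square algebra_simps flip: \<mu>(1))
    have "R * (x - a) * (\<tau> * R * h * x - k) = \<tau> * (R\<^sup>2 * h) * ((x - a) * (x - k / (\<tau> * R * h)))"
      using P \<tau> by (simp add: right_diff_distrib power2_eq_square, simp add: algebra_simps)
    also have "\<dots> = \<tau> * T * m\<^sup>2 * x"
      unfolding x using P by simp
    finally have "R * (x - a) * (\<tau> * R * h * x - k) = \<tau> * T * m\<^sup>2 * x" .
    then have "\<tau> * \<mu>\<^sup>2 * T * m * m + k * R * (x - a) = \<mu>\<^sup>2 * \<tau> * R * h * (R * (x - a))"
      unfolding \<mu>(1) by (simp add: power2_eq_square algebra_simps)
    then have "T * m * (\<mu> * m) + k * R * (x - a) / (\<tau> * \<mu>) = \<mu> * R * h * (R * (x - a))"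
      using \<mu>(2) \<tau> by (simp add: field_simps power2_eq_square)
    then show "T * m * (\<xi> \<bullet> (\<mu> * m) *\<^sub>R \<xi>)
        + \<xi> \<bullet> (m *\<^sub>R ((\<xi> \<bullet> q) *\<^sub>R \<xi> - q) + (k * R * (x - a) / (\<tau> * \<mu>)) *\<^sub>R \<xi>)
      = \<mu> * R * h * (R * (x - a))"
      by (simp add: \<xi> inner_add_right inner_diff_right)
    show "\<tau> *\<^sub>R ((q \<bullet> (\<mu> * m) *\<^sub>R \<xi>) *\<^sub>R \<xi> - (\<xi> \<bullet> (\<mu> * m) *\<^sub>R \<xi>) *\<^sub>R q) + (k * (R * (x - a))) *\<^sub>R \<xi>
      = (\<mu> * \<tau>) *\<^sub>R (m *\<^sub>R ((\<xi> \<bullet> q) *\<^sub>R \<xi> - q) + (k * R * (x - a) / (\<tau> * \<mu>)) *\<^sub>R \<xi>)"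
      using \<mu>(2) \<tau> by (simp add: vec_eq_iff \<xi> inner_commute [of q] field_simps)
  qed
  \<comment> \<open>Sums and differences over the two signs of \<open>\<mu>\<close> separate density
    and temperature from longitudinal velocity and flux. The transversal flux is even in
    \<open>\<mu>\<close>: it cancels in \<open>odd\<close> and is removed by
    \<open>flux_perp\<close> in \<open>even\<close>.\<close>
  have even: "block (R * m) 0 (R * (x - a)) 0 \<in> span ?E"
    and odd: "block 0 ((x * m) *\<^sub>R \<xi>) 0 ((k * R * (x - a) / \<tau>) *\<^sub>R \<xi>) \<in> span ?E"
    if x: "(x - a) * (x - k / (\<tau> * R * h)) = T * m\<^sup>2 / (R\<^sup>2 * h) * x" and "x > 0" for x
  proof -
    define \<mu> where "\<mu> = sqrt x"
    have \<mu>: "\<mu>\<^sup>2 = x" "\<mu> \<noteq> 0" "(- \<mu>)\<^sup>2 = x" "- \<mu> \<noteq> 0" using \<open>x > 0\<close> by (simp_all add: \<mu>_def)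
    have perp: "block 0 0 0 (m *\<^sub>R ((\<xi> \<bullet> q) *\<^sub>R \<xi> - q)) \<in> span ?E"
      by (rule flux_perp) (simp add: inner_diff_right \<xi>)
    note pm = acoustic [OF x \<mu>(1,2)] acoustic [OF x \<mu>(3,4)]
    have "block (R * m) 0 (R * (x - a)) 0 =
      (1/2) *\<^sub>R block (R * m) ((\<mu> * m) *\<^sub>R \<xi>) (R * (x - a))
        (m *\<^sub>R ((\<xi> \<bullet> q) *\<^sub>R \<xi> - q) + (k * R * (x - a) / (\<tau> * \<mu>)) *\<^sub>R \<xi>)
      + (1/2) *\<^sub>R block (R * m) ((- \<mu> * m) *\<^sub>R \<xi>) (R * (x - a))
        (m *\<^sub>R ((\<xi> \<bullet> q) *\<^sub>R \<xi> - q) + (k * R * (x - a) / (\<tau> * - \<mu>)) *\<^sub>R \<xi>)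
      + (- 1) *\<^sub>R block 0 0 0 (m *\<^sub>R ((\<xi> \<bullet> q) *\<^sub>R \<xi> - q))"
      unfolding state_eq_iff state_add state_scaleR block_sel
        by (simp add: vec_eq_iff algebra_simps)
    also have "\<dots> \<in> span ?E"
      by (intro span_add span_scale pm perp)
    finally show "block (R * m) 0 (R * (x - a)) 0 \<in> span ?E" .
    have "block 0 ((x * m) *\<^sub>R \<xi>) 0 ((k * R * (x - a) / \<tau>) *\<^sub>R \<xi>) =
      (\<mu>/2) *\<^sub>R block (R * m) ((\<mu> * m) *\<^sub>R \<xi>) (R * (x - a))
        (m *\<^sub>R ((\<xi> \<bullet> q) *\<^sub>R \<xi> - q) + (k * R * (x - a) / (\<tau> * \<mu>)) *\<^sub>R \<xi>)
      + (- \<mu>/2) *\<^sub>R block (R * m) ((- \<mu> * m) *\<^sub>R \<xi>) (R * (x - a))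
        (m *\<^sub>R ((\<xi> \<bullet> q) *\<^sub>R \<xi> - q) + (k * R * (x - a) / (\<tau> * - \<mu>)) *\<^sub>R \<xi>)"
      using \<mu>(2) \<tau> unfolding state_eq_iff state_add state_scaleR block_sel
        by (simp add: vec_eq_iff field_simps power2_eq_square flip: \<mu>(1))
    also have "\<dots> \<in> span ?E"
      by (intro span_add span_scale pm)
    finally show "block 0 ((x * m) *\<^sub>R \<xi>) 0 ((k * R * (x - a) / \<tau>) *\<^sub>R \<xi>) \<in> span ?E" .
  qed
  \<comment> \<open>The even vectors for \<open>y\<close> and \<open>z\<close> share the density
    \<open>R * m\<close>, so their difference is purely thermal, and nonzero since \<open>y\<close>
    and \<open>z\<close> differ.\<close>
  have th: "block 0 0 t 0 \<in> span ?E" for t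
  proof -
    define c where "c = t / (R * (y - z))"
    have "c * (R * (y - z)) = t" using P yz by (simp add: c_def)
    then have "block 0 0 t 0 = c *\<^sub>R block (R * m) 0 (R * (y - a)) 0
        + (- c) *\<^sub>R block (R * m) 0 (R * (z - a)) 0"
      unfolding state_eq_iff state_add state_scaleR block_sel
        by (simp add: algebra_simps)
    also have "\<dots> \<in> span ?E"
      by (intro span_add span_scale even y z yz)
    finally show ?thesis .
  qed
  have rh: "block r 0 0 0 \<in> span ?E" for r
  proof -
    have "block r 0 0 0 = (r / (R * m)) *\<^sub>R block (R * m) 0 (R * (y - a)) 0
        + block 0 0 (- (r / (R * m)) * (R * (y - a))) 0"
      using P by (simp add: state_eq_iff)
    also have "\<dots> \<in> span ?E"
      by (intro span_add span_scale even th y yz)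
    finally show ?thesis .
  qed
  have long: "block 0 (c *\<^sub>R \<xi>) 0 (d *\<^sub>R \<xi>) \<in> span ?E" for c d
  proof -
    define K where "K = k * R / \<tau>"
    have K: "K > 0" using P \<tau> by (simp add: K_def)
    \<comment> \<open>Cramer's rule for the combination of the two odd vectors:
      \<open>\<Delta>\<close> is, up to sign, the determinant of the columns (y m, K (y - a)) and (z
      m, K (z - a)), in which the y z terms cancel.\<close>
    define \<Delta> where "\<Delta> = m * K * a * (y - z)"
    have \<Delta>: "\<Delta> \<noteq> 0" using P K yz by (simp add: \<Delta>_def)
    define \<alpha> where "\<alpha> = (d * z * m - c * K * (z - a)) / \<Delta>"
    define \<beta> where "\<beta> = (c * K * (y - a) - d * y * m) / \<Delta>"
    have num: "(d * z * m - c * K * (z - a)) * (y * m) + (c * K * (y - a) - d * y * m) * (z * m)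
        = c * \<Delta>"
      "(d * z * m - c * K * (z - a)) * (K * (y - a)) + (c * K * (y - a) - d * y * m) * (K * (z - a))
        = d * \<Delta>"
      by (simp_all add: \<Delta>_def algebra_simps)
    have 1: "\<alpha> * (y * m) + \<beta> * (z * m) = c"
      using num(1) \<Delta> by (simp add: \<alpha>_def \<beta>_def flip: add_divide_distrib)
    have "\<alpha> * (K * (y - a)) + \<beta> * (K * (z - a)) = d"
      using num(2) \<Delta> by (simp add: \<alpha>_def \<beta>_def flip: add_divide_distrib)
    then have 2: "\<alpha> * (k * R * (y - a) / \<tau>) + \<beta> * (k * R * (z - a) / \<tau>) = d"
      by (simp add: K_def)
    have "block 0 (c *\<^sub>R \<xi>) 0 (d *\<^sub>R \<xi>)
      = \<alpha> *\<^sub>R block 0 ((y * m) *\<^sub>R \<xi>) 0 ((k * R * (y - a) / \<tau>) *\<^sub>R \<xi>)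
      + \<beta> *\<^sub>R block 0 ((z * m) *\<^sub>R \<xi>) 0 ((k * R * (z - a) / \<tau>) *\<^sub>R \<xi>)"
      unfolding state_eq_iff state_add state_scaleR block_sel scaleR_scaleR
        scaleR_add_left [symmetric] 1 2 by simp
    also have "\<dots> \<in> span ?E"
      by (intro span_add span_scale odd y z yz)
    finally show ?thesis .
  qed
  have "V \<in> span ?E" for V
  proof -
    define w where "w = vel V - (\<xi> \<bullet> vel V) *\<^sub>R \<xi>"
    define s where "s = flux V - (\<xi> \<bullet> flux V) *\<^sub>R \<xi>"
    have perp: "\<xi> \<bullet> w = 0" "\<xi> \<bullet> s = 0"
      by (simp_all add: w_def s_def inner_diff_right \<xi>)
    \<comment> \<open>The transversal velocity brings along a density and a temperature from
      \<open>vel_perp\<close>; the last two terms compensate for them.\<close>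
    have "V = block (m * \<tau> * (q \<bullet> w) / (k * a)) w (- \<tau> * (q \<bullet> w) / k) 0 + block 0 0 0 s
      + block 0 ((\<xi> \<bullet> vel V) *\<^sub>R \<xi>) 0 ((\<xi> \<bullet> flux V) *\<^sub>R \<xi>)
      + block (rho V - m * \<tau> * (q \<bullet> w) / (k * a)) 0 0 0
      + block 0 0 (theta V - (- \<tau> * (q \<bullet> w) / k)) 0"
      unfolding state_eq_iff state_add block_sel by (simp add: w_def s_def)
    also have "\<dots> \<in> span ?E"
      by (intro span_add vel_perp flux_perp long rh th perp)
    finally show ?thesis .
  qed
  then show ?thesis by blast
qed

theorem theorem6p2:
  fixes p e \<kappa> lam nu :: "real \<times> real \<Rightarrow> real" and \<tau> :: real
  assumes "smooth_on_D p" and "smooth_on_D e" and "smooth_on_D \<kappa>"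
    and "\<forall>x\<in>D. p x > 0 \<and> d_rho p x > 0 \<and> d_theta p x > 0 \<and> d_theta e x > 0 \<and> \<kappa> x > 0"
    and "\<tau> > 0"
    and "\<forall>x\<in>D. lam x + nu x = 0"
  shows "hyperbolic (ln_system p e \<kappa> \<tau> lam nu) \<longleftrightarrow> (\<forall>x\<in>D. lam x = 1 \<and> nu x = -1)"
proof
  assume hyp: "hyperbolic (ln_system p e \<kappa> \<tau> lam nu)"
  show "\<forall>x\<in>D. lam x = 1 \<and> nu x = -1"
  proof
    fix x assume x: "x \<in> D"
    then have "lam x = 1"
      using hyperbolic_imp_lam_eq_1 [OF hyp] assms(5,6) by (auto simp: D_def)
    then show "lam x = 1 \<and> nu x = -1"
      using assms(6) x by (auto simp: add_eq_0_iff)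
  qed
next
  assume ln: "\<forall>x\<in>D. lam x = 1 \<and> nu x = -1"
  show "hyperbolic (ln_system p e \<kappa> \<tau> lam nu)"
    unfolding hyperbolic_def symbol_ln_system
  proof (intro ballI conjI)
    fix U :: state and \<xi> :: "real ^ 3"
    assume "U \<in> states" and "\<xi> \<in> sphere 0 1"
    then have U: "rho U > 0" "theta U > 0" and x: "(rho U, theta U) \<in> D" and \<xi>: "\<xi> \<bullet> \<xi> = 1"
      by (auto simp: states_def D_def norm_eq_1)
    have A0: "A0 (ln_system p e \<kappa> \<tau> lam nu) U = A0_ln e \<tau> U"
      by (simp add: ln_system_def)
    have inv: "invertible (A0_ln e \<tau> U)"
      using U x assms by (intro invertible_A0_ln) auto
    have span: "span {V. \<exists>\<eta>. gen_eigenvector (A_ln p e \<kappa> \<tau> lam nu \<xi> U) (A0_ln e \<tau> U) \<eta> V} = UNIV"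
      (is "span ?E = UNIV")
      using U x \<xi> assms ln by (intro span_eigenvectors_ln) auto
    show "invertible (A0 (ln_system p e \<kappa> \<tau> lam nu) U)"
      using inv A0 by simp
    show "\<forall>\<eta>. gen_eigenvalue (complexify (A_ln p e \<kappa> \<tau> lam nu \<xi> U))
        (complexify (A0 (ln_system p e \<kappa> \<tau> lam nu) U)) \<eta> \<longrightarrow> \<eta> \<in> \<real>"
      using gen_eigenvalue_real [OF inv span] A0 by simp
    \<comment> \<open>Choosing the basis inside \<open>?E\<close> keeps all its members
      eigenvectors.\<close>
    obtain B where B: "B \<subseteq> ?E" "independent B" "?E \<subseteq> span B" "card B = dim ?E"
      using basis_exists by blast
    have "dim ?E = 8"
      by (metis span dim_span dim_UNIV DIM_cart DIM_real CARD_comp mult.right_neutral)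
    then show "\<exists>B. independent B \<and> card B = 8 \<and> (\<forall>V\<in>B. \<exists>\<eta>. gen_eigenvector
        (A_ln p e \<kappa> \<tau> lam nu \<xi> U) (A0 (ln_system p e \<kappa> \<tau> lam nu) U) \<eta> V)"
      using B A0 by (intro exI [of _ B]) auto
  qed
qed

end
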